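(* Let $r$ be a complex number and let $m,n\ge0$ be integers. Then, as polynomials in $x$, $$D_m^{(r)}(x)D_n^{(r)}(x)=\sum_{k=0}^{\min\{m,n\}}\binom{m}{k}\binom{n}{k}k!^2\binom{2r+m+n-k}{k} D_{m+n-2k}^{(r)}(x).$$
   Context: For a complex number $a$ and integer $k\ge0$, $\binom{a}{k}=a(a-1)\cdots(a-k+1)/k!$. For a parameter $r$, the polynomials $D_n^{(r)}(x)$ are defined by $D_{-1}^{(r)}(x)=0$, $D_0^{(r)}(x)=1$ and $D_{n+1}^{(r)}(x)=xD_n^{(r)}(x)-n(n+2r)D_{n-1}^{(r)}(x)$ for $n\ge0$. *)

theory Defs
  imports Complex_Main "HOL-Computational_Algebra.Polynomial"
begin

text \<open>
  The recurrence \<open>D\<^sub>n\<^sub>+\<^sub>1 = x D\<^sub>n - n (n + 2r) D\<^sub>n\<^sub>-\<^sub>1\<close>, \<open>n \<ge> 0\<close>, with \<open>D\<^sub>-\<^sub>1 = 0\<close> and \<open>D\<^sub>0 = 1\<close>.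
  As indices are natural numbers, its instance \<open>n = 0\<close>, the only one involving \<open>D\<^sub>-\<^sub>1\<close>, is written
  out as \<open>D\<^sub>1 = x D\<^sub>0\<close>; the third equation is the instance \<open>n + 1\<close>.
\<close>

fun D :: "complex \<Rightarrow> nat \<Rightarrow> complex poly" where
  "D r 0 = 1"
| "D r (Suc 0) = [:0, 1:] * D r 0"
| "D r (Suc (Suc n)) = [:0, 1:] * D r (Suc n)
      - smult (of_nat (Suc n) * (of_nat (Suc n) + 2 * r)) (D r n)"

lemma D_rec:
  "D r (Suc n) = [:0, 1:] * D r n
      - smult (of_nat n * (of_nat n + 2 * r)) (if n = 0 then 0 else D r (n - 1))"
  by (cases n) simp_all

end

theory Submission
  imports Defs
begin

text \<open>
  Induction on \<open>m\<close>. In \<open>D\<^sub>m\<^sub>+\<^sub>1 D\<^sub>n = x D\<^sub>m D\<^sub>n - m (m + 2r) D\<^sub>m\<^sub>-\<^sub>1 D\<^sub>n\<close> expand both products on the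
  right by the induction hypothesis and absorb \<open>x\<close> into each \<open>D\<^sub>j\<close> by the recurrence. Comparing the
  coefficients of \<open>D\<^sub>m\<^sub>+\<^sub>n\<^sub>-\<^sub>1\<^sub>-\<^sub>2\<^sub>j\<close> leaves a three-term recurrence for the linearization coefficients;
  after division by common binomial factors it is a polynomial identity.
\<close>

text \<open>The upper arguments lie in a field rather than in \<open>nat\<close>, so that
  \<open>a - 1\<close> is never truncated and \<open>lin_coeff_rec\<close> can be proved with
  \<open>a\<close> and \<open>b\<close> free.\<close>

definition lin_coeff :: "'a::field_char_0 \<Rightarrow> 'a \<Rightarrow> 'a \<Rightarrow> nat \<Rightarrow> 'a" where
  "lin_coeff r a b k =
    (a gchoose k) * (b gchoose k) * (fact k)\<^sup>2 * ((2 * r + a + b - of_nat k) gchoose k)"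

lemma lin_coeff_0 [simp]: "lin_coeff r a b 0 = 1"
  by (simp add: lin_coeff_def)

lemma lin_coeff_of_nat:
  "lin_coeff r (of_nat m) (of_nat n) k =
    of_nat (m choose k) * of_nat (n choose k) * (fact k)\<^sup>2
      * ((2 * r + of_nat m + of_nat n - of_nat k) gchoose k)"
  by (simp add: lin_coeff_def binomial_gbinomial)

lemma lin_coeff_eq_0:
  "min m n < k \<Longrightarrow> lin_coeff r (of_nat m) (of_nat n) k = 0"
  by (auto simp: lin_coeff_of_nat min_less_iff_disj binomial_eq_0)

lemma gbinomial_Suc_eq:
  fixes a :: "'a::field_char_0"
  shows "a gchoose Suc k = (a - of_nat k) / of_nat (Suc k) * (a gchoose k)"
    and "a gchoose Suc k = a / of_nat (Suc k) * ((a - 1) gchoose k)"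
  using gbinomial_absorption'[of "Suc k" a] gbinomial_absorb_comp[of a k]
  by (simp_all add: field_simps)

text \<open>In each use of \<open>gbinomial_Suc_eq\<close> the form is chosen so that the upper
  arguments end as \<open>a\<close>, \<open>b\<close> and \<open>s - i - 1\<close>; every term is
  then a multiple of \<open>A * B * (fact j)^2 * V\<close>.\<close>

lemma lin_coeff_rec:
  fixes r a b :: "'a::field_char_0"
  shows "lin_coeff r (a + 1) b (Suc j) = lin_coeff r a b (Suc j)
    + (a + b - 2 * of_nat j) * (a + b - 2 * of_nat j + 2 * r) * lin_coeff r a b j
    - a * (a + 2 * r) * lin_coeff r (a - 1) b j"
proof -
  define i where "i = (of_nat j :: 'a)"
  define s where "s = 2 * r + a + b"
  define A where "A = (a gchoose j)"
  define B where "B = (b gchoose j)"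
  define U where "U = ((s - i) gchoose j)"
  define V where "V = ((s - i - 1) gchoose j)"
  have i1: "i + 1 \<noteq> 0" "1 + i \<noteq> 0"
    unfolding i_def by (metis of_nat_Suc of_nat_neq_0 add.commute)+
  have UV: "(s - 2 * i) * U = (s - i) * V"
    using gbinomial_absorb_comp[of "s - i" j] by (simp add: U_def V_def i_def algebra_simps)
  have A: "a * ((a - 1) gchoose j) = (a - i) * A"
    using gbinomial_absorb_comp[of a j] by (simp add: A_def i_def)
  have L1: "lin_coeff r (a + 1) b (Suc j) =
      (a + 1) * A * ((b - i) * B) * (fact j)\<^sup>2 * ((s - i) * V) / (i + 1)"
  proof -
    have e: "2 * r + (a + 1) + b - of_nat (Suc j) = s - i"
      by (simp add: s_def i_def)
    have "lin_coeff r (a + 1) b (Suc j) = ((a + 1) / (i + 1) * A) * ((b - i) / (i + 1) * B)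
        * ((i + 1) * fact j)\<^sup>2 * ((s - i) / (i + 1) * V)"
      unfolding lin_coeff_def e gbinomial_Suc_eq(2)[of "a + 1" j] gbinomial_Suc_eq(1)[of b j]
        gbinomial_Suc_eq(2)[of "s - i" j]
      by (simp add: A_def B_def V_def i_def add.commute)
    then show ?thesis
      using i1 by (simp add: power2_eq_square)
  qed
  have L2: "lin_coeff r a b (Suc j) =
      (a - i) * A * ((b - i) * B) * (fact j)\<^sup>2 * ((s - 2 * i - 1) * V) / (i + 1)"
  proof -
    have e: "2 * r + a + b - of_nat (Suc j) = s - i - 1"
      by (simp add: s_def i_def)
    have "lin_coeff r a b (Suc j) = ((a - i) / (i + 1) * A) * ((b - i) / (i + 1) * B)
        * ((i + 1) * fact j)\<^sup>2 * ((s - 2 * i - 1) / (i + 1) * V)"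
      unfolding lin_coeff_def e gbinomial_Suc_eq(1)[of a j] gbinomial_Suc_eq(1)[of b j]
        gbinomial_Suc_eq(1)[of "s - i - 1" j]
      by (simp add: A_def B_def V_def i_def algebra_simps)
    then show ?thesis
      using i1 by (simp add: power2_eq_square)
  qed
  \<comment> \<open>The factors \<open>s - 2 * i\<close> here and \<open>a\<close> in
    \<open>L4\<close> stay on the left: the recurrence supplies both, since
    \<open>s - 2 * i = a + b - 2 * i + 2 * r\<close>, and either may be zero, so neither is divided
    out.\<close>
  have L3: "(s - 2 * i) * lin_coeff r a b j = A * B * (fact j)\<^sup>2 * ((s - i) * V)"
    unfolding UV[symmetric] by (simp add: lin_coeff_def A_def B_def U_def s_def i_def)
  have L4: "a * lin_coeff r (a - 1) b j = (a - i) * A * B * (fact j)\<^sup>2 * V"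
  proof -
    have e: "2 * r + (a - 1) + b - of_nat j = s - i - 1"
      by (simp add: s_def i_def)
    have "a * lin_coeff r (a - 1) b j = (a * ((a - 1) gchoose j)) * B * (fact j)\<^sup>2 * V"
      unfolding lin_coeff_def e by (simp add: B_def V_def)
    then show ?thesis by (simp add: A)
  qed
  \<comment> \<open>The polynomial identity left once the common factor is removed and the
    denominator \<open>i + 1\<close> is cleared.\<close>
  have "(a + 1) * (b - i) * (s - i) - (a - i) * (b - i) * (s - 2 * i - 1)
      = (i + 1) * ((a + b - 2 * i) * (s - i) - (a - i) * (a + 2 * r))"
    unfolding s_def by algebra
  then have "lin_coeff r (a + 1) b (Suc j) - lin_coeff r a b (Suc j)
      = A * B * (fact j)\<^sup>2 * V * ((a + b - 2 * i) * (s - i) - (a - i) * (a + 2 * r))"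
    unfolding L1 L2 diff_divide_distrib[symmetric]
    apply (subst nonzero_divide_eq_eq[OF i1(1)])
    by algebra
  also have "\<dots> = (a + b - 2 * i) * ((s - 2 * i) * lin_coeff r a b j)
      - (a + 2 * r) * (a * lin_coeff r (a - 1) b j)"
    unfolding L3 L4 by algebra
  finally show ?thesis
    by (simp add: s_def i_def algebra_simps)
qed

text \<open>At \<open>j = 0\<close> the factor \<open>of_nat j\<close> kills the term in which
  \<open>j - 1\<close> is truncated.\<close>

lemma X_mult_D:
  "[:0, 1:] * D r j = D r (Suc j) + smult (of_nat j * (of_nat j + 2 * r)) (D r (j - 1))"
  by (cases j) simp_all

lemma smult_sum_right: "smult c (sum f A) = (\<Sum>x\<in>A. smult c (f x))"
  by (induction A rule: infinite_finite_induct) (simp_all add: smult_add_right)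

text \<open>
  Wherever the truncated \<open>m + n - 2 * k\<close> differs from the true difference, \<open>k\<close> exceeds \<open>min m n\<close>
  and the coefficient vanishes.
\<close>

lemma D_mult_D:
  "D r m * D r n =
    (\<Sum>k\<le>n. smult (lin_coeff r (of_nat m) (of_nat n) k) (D r (m + n - 2 * k)))"
proof (induction m rule: less_induct)
  case (less m)
  show ?case
  proof (cases m)
    case 0
    then show ?thesis
      by (subst sum.remove[of _ 0]) (auto simp: lin_coeff_eq_0[of 0, simplified])
  next
    case (Suc p)
    let ?c = "\<lambda>m k. lin_coeff r (of_nat m) (of_nat n) k"
    let ?w = "\<lambda>j. of_nat j * (of_nat j + 2 * r) :: complex"
    \<comment> \<open>For \<open>k \<le> min p n\<close>, multiplication by the variable sends
      \<open>D r (p + n - 2 * k)\<close> to a combination of \<open>?E k\<close> and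
      \<open>?E (Suc k)\<close>, so all sums can be compared over this one family.\<close>
    let ?E = "\<lambda>k. D r (Suc p + n - 2 * k)"
    \<comment> \<open>The bound \<open>n\<close> is independent of the first index, so this serves
      both \<open>q = p\<close> and \<open>q = Suc p\<close>. The term added at \<open>Suc n\<close>
      has coefficient zero.\<close>
    have shift: "(\<Sum>k\<le>n. smult (?c q k) (?E k)) = ?E 0 + (\<Sum>j\<le>n. smult (?c q (Suc j)) (?E (Suc j)))"
      for q
    proof -
      have "(\<Sum>k\<le>n. smult (?c q k) (?E k)) = (\<Sum>k\<le>Suc n. smult (?c q k) (?E k))"
        by (simp add: lin_coeff_eq_0)
      also have "\<dots> = ?E 0 + (\<Sum>j\<le>n. smult (?c q (Suc j)) (?E (Suc j)))"
        by (subst sum.atMost_Suc_shift) simp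
      finally show ?thesis .
    qed
    have "[:0, 1:] * (D r p * D r n) =
        (\<Sum>k\<le>n. smult (?c p k) ([:0, 1:] * D r (p + n - 2 * k)))"
      using Suc by (simp add: less sum_distrib_left)
    also have "\<dots> = (\<Sum>k\<le>n. smult (?c p k) (?E k))
        + (\<Sum>k\<le>n. smult (?c p k * ?w (p + n - 2 * k)) (?E (Suc k)))"
      unfolding sum.distrib[symmetric]
    proof (rule sum.cong[OF refl])
      fix k
      show "smult (?c p k) ([:0, 1:] * D r (p + n - 2 * k)) =
          smult (?c p k) (?E k) + smult (?c p k * ?w (p + n - 2 * k)) (?E (Suc k))"
      proof (cases "k \<le> min p n")
        case True
        then have "Suc (p + n - 2 * k) = Suc p + n - 2 * k" by auto
        moreover have "p + n - 2 * k - 1 = Suc p + n - 2 * Suc k" by auto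
        ultimately show ?thesis
          by (simp only: X_mult_D smult_add_right smult_smult)
      next
        case False
        then have "?c p k = 0" by (intro lin_coeff_eq_0) (rule not_le_imp_less)
        then show ?thesis by simp
      qed
    qed
    finally have x: "[:0, 1:] * (D r p * D r n) = \<dots>" .
    \<comment> \<open>For \<open>p = 0\<close> both sides vanish with \<open>?w p\<close>, whatever
      \<open>lin_coeff\<close> is at \<open>-1\<close>; otherwise \<open>of_nat p - 1\<close> is the
      predecessor of \<open>p\<close> and the induction hypothesis applies.\<close>
    have y: "smult (?w p) (D r (p - 1) * D r n) =
        (\<Sum>k\<le>n. smult (?w p * lin_coeff r (of_nat p - 1) (of_nat n) k) (?E (Suc k)))"
    proof (cases p)
      case (Suc q)
      then show ?thesis
        using less[of q] \<open>m = Suc p\<close> by (simp add: smult_sum_right algebra_simps)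
    qed simp
    have rec: "?c (Suc p) (Suc k) = ?c p (Suc k) + ?c p k * ?w (p + n - 2 * k)
        - ?w p * lin_coeff r (of_nat p - 1) (of_nat n) k" for k
    proof -
      have "?c p k * ?w (p + n - 2 * k) = (of_nat p + of_nat n - 2 * of_nat k)
          * (of_nat p + of_nat n - 2 * of_nat k + 2 * r) * ?c p k"
      proof (cases "k \<le> min p n")
        case True
        then have "of_nat (p + n - 2 * k) = (of_nat p + of_nat n - 2 * of_nat k :: complex)"
          by (subst of_nat_diff) auto
        then show ?thesis by simp
      next
        case False
        then have "?c p k = 0" by (intro lin_coeff_eq_0) (rule not_le_imp_less)
        then show ?thesis by simp
      qed
      then show ?thesis
        by (simp only: lin_coeff_rec of_nat_Suc add.commute[of 1])
    qed
    have "D r m = [:0, 1:] * D r p - smult (?w p) (D r (p - 1))"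
      by (simp only: X_mult_D Suc add_diff_cancel_right')
    then have "D r m * D r n =
        [:0, 1:] * (D r p * D r n) - smult (?w p) (D r (p - 1) * D r n)"
      by (simp only: left_diff_distrib mult.assoc mult_smult_left)
    also have "\<dots> = ?E 0 + (\<Sum>j\<le>n. smult (?c (Suc p) (Suc j)) (?E (Suc j)))"
      unfolding x y shift rec smult_diff_left smult_add_left sum.distrib sum_subtractf
      by (simp only: add.assoc add_diff_eq)
    finally show ?thesis
      unfolding shift[symmetric] Suc .
  qed
qed

theorem theorem3p7:
  fixes r :: complex and m n :: nat
  shows "D r m * D r n =
    (\<Sum>k = 0..min m n.
      smult (of_nat (m choose k) * of_nat (n choose k) * (fact k)\<^sup>2
             * ((2 * r + of_nat m + of_nat n - of_nat k) gchoose k))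
        (D r (m + n - 2 * k)))"
  unfolding D_mult_D lin_coeff_of_nat[symmetric]
  by (rule sum.mono_neutral_right) (auto simp: lin_coeff_eq_0)

end
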